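(* For every operator $H\in\mathcal{S}_Y(c_0)$ there exists $f\in C(\mathbb{N}^{*})$ such that $$H=\int_{\mathbb{N}^{*}}f\,dm,$$ where $m:\Omega(\mathbb{N}^{*})\to\mathcal{S}_Y(c_0)$ is the projection-valued measure associated with $Y$ and the integral is the limit, in the operator norm, of the Riemann-type sums $\omega_\alpha(f,m,\mathbb{N}^{*})$ along the directed set $\mathcal{D}_{\mathbb{N}^{*}}$ (all as defined in the context).
   Context: $\mathbb{K}$ is a complete non-archimedean valued field whose residue class field is formally real. $c_0$ is the Banach space of sequences $x=(x_n)_{n\in\mathbb{N}}$ in $\mathbb{K}$ with $x_n\to 0$ ($\mathbb{N}=\{1,2,\dots\}$), with norm $\|x\|_\infty=\sup_n|x_n|$ and bilinear form $\langle x,y\rangle=\sum_n x_ny_n$; one has $\|x\|_\infty=\sqrt{|\langle x,x\rangle|}$. $Y=\{y^{(i)}\}_{i\in\mathbb{N}}$ is a fixed orthonormal sequence in $c_0$: $\langle y^{(i)},y^{(j)}\rangle=0$ for $i\ne j$ and $\|y^{(i)}\|_\infty=1$. Put $P_i(x)=\frac{\langle x,y^{(i)}\rangle}{\langle y^{(i)},y^{(i)}\rangle}y^{(i)}$. For $\lambda=(\lambda_i)\in c_0$ let $T_\lambda=\sum_{i=1}^\infty\lambda_iP_i$. $\mathcal{S}_Y(c_0)=\{\alpha Id+T_\lambda:\alpha\in\mathbb{K},\lambda\in c_0\}$, where $Id$ is the identity operator, with the operator norm and composition. $\mathbb{N}^{*}=\mathbb{N}\cup\{0\}$ is the one-point compactification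 of the discrete space $\mathbb{N}$, with $0$ as the point at infinity; $C(\mathbb{N}^{*})$ is the algebra of continuous functions $\mathbb{N}^{*}\to\mathbb{K}$ with the supremum norm. $\Omega(\mathbb{N}^{*})$ is the Boolean ring of clopen subsets of $\mathbb{N}^{*}$; its elements are exactly the finite subsets of $\mathbb{N}$ and their complements in $\mathbb{N}^{*}$. The finitely additive set function $m:\Omega(\mathbb{N}^{*})\to\mathcal{S}_Y(c_0)$ is given by $m(\varnothing)=0$, $m(\mathbb{N}^{*})=Id$, $m(\{n_1,\dots,n_k\})=\sum_{i=1}^kP_{n_i}$ and $m(\mathbb{N}^{*}\setminus\{n_1,\dots,n_k\})=Id-\sum_{i=1}^kP_{n_i}$ for distinct $n_1,\dots,n_k\in\mathbb{N}$. $\mathcal{D}_{\mathbb{N}^{*}}$ is the set of all $\alpha=\{C_1,\dots,C_n;x_1,\dots,x_n\}$ where $\{C_1,\dots,C_n\}$ is a finite partition of $\mathbb{N}^{*}$ into (nonempty) clopen sets and $x_k\in C_k$; it is directed by $\alpha_1\ge\alpha_2$ iff the partition of $\alpha_1$ refines the partition of $\alpha_2$. For $f\in C(\mathbb{N}^{*})$, $\omega_\alpha(f,m,\mathbb{N}^{*})=\sum_{k=1}^nf(x_k)\,m(C_k)$, and $\int_{\mathbb{N}^{*}}f\,dm=\lim_{\alpha\in\mathcal{D}_{\mathbb{N}^{*}}}\omega_\alpha(f,m,\mathbb{N}^{*})$. *)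

theory Defs
  imports "HOL-Algebra.QuotRing" "HOL-Analysis.Analysis"
begin

section \<open>Complete non-archimedean valued fields\<close>

text \<open>
  The library reserves \<^const>\<open>norm\<close> for real normed vector spaces, hence a new overloaded
  \<open>vnorm\<close>: the valuation on the field, the supremum vnorm on \<open>c\<^sub>0\<close>, the operator norm on operators.
  Topology and uniformity are those of the metric. The trivial valuation is not excluded.
\<close>

class nonarch_normed = ab_group_add + metric_space +
  fixes vnorm :: "'a \<Rightarrow> real"
  assumes dist_vnorm: "dist x y = vnorm (x - y)"
    and vnorm_ultra: "vnorm (x + y) \<le> max (vnorm x) (vnorm y)"

class nonarch_valued_field = field + nonarch_normed +
  assumes vnorm_mult: "vnorm (x * y) = vnorm x * vnorm y"

class complete_valued_field = nonarch_valued_field + complete_space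

definition valuation_ring :: "'k::nonarch_valued_field ring" where
  "valuation_ring =
    \<lparr>carrier = {x. vnorm x \<le> 1}, monoid.mult = (*), one = 1, zero = 0, add = (+)\<rparr>"

definition residue_field :: "'k::nonarch_valued_field set ring" where
  "residue_field = valuation_ring Quot {x. vnorm x < 1}"

definition formally_real :: "('a, 'b) ring_scheme \<Rightarrow> bool" where
  "formally_real R \<longleftrightarrow> Ring.field R \<and>
     (\<forall>(n::nat) a. a \<in> {..<n} \<rightarrow> carrier R \<longrightarrow>
        (\<Oplus>\<^bsub>R\<^esub>i\<in>{..<n}. a i \<otimes>\<^bsub>R\<^esub> a i) = \<zero>\<^bsub>R\<^esub> \<longrightarrow> (\<forall>i<n. a i = \<zero>\<^bsub>R\<^esub>))"

lemma vnorm_zero [simp]: "vnorm (0::'k::nonarch_normed) = 0"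
  using dist_vnorm[of "0::'k" 0] by simp

lemma vnorm_eq_zero [simp]: "vnorm (x::'k::nonarch_normed) = 0 \<longleftrightarrow> x = 0"
  using dist_vnorm[of x 0] by (metis diff_zero dist_eq_0_iff)

lemma vnorm_nonneg [simp]: "0 \<le> vnorm (x::'k::nonarch_normed)"
  using dist_vnorm[of x 0] by (metis diff_zero zero_le_dist)

lemma vnorm_pos: "x \<noteq> 0 \<Longrightarrow> 0 < vnorm (x::'k::nonarch_normed)"
  by (metis vnorm_nonneg vnorm_eq_zero less_eq_real_def)

lemma vnorm_minus [simp]: "vnorm (- x) = vnorm (x::'k::nonarch_normed)"
  by (metis diff_0 diff_zero dist_commute dist_vnorm)

lemma vnorm_dist0: "vnorm (x::'k::nonarch_normed) = dist x 0"
  by (simp add: dist_vnorm)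

lemma vnorm_triangle: "vnorm (x + y) \<le> vnorm x + vnorm (y::'k::nonarch_normed)"
  using vnorm_ultra[of x y] vnorm_nonneg[of x] vnorm_nonneg[of y] by linarith

lemma vnorm_one [simp]: "vnorm (1::'k::nonarch_valued_field) = 1"
proof -
  have "vnorm (1::'k) * vnorm (1::'k) = vnorm (1::'k) * 1"
    by (metis mult.right_neutral vnorm_mult)
  then show ?thesis
    by (metis mult_cancel_left vnorm_eq_zero zero_neq_one)
qed

lemma vnorm_sum_le:
  fixes f :: "'i \<Rightarrow> 'k::nonarch_normed"
  assumes "\<And>i. i \<in> A \<Longrightarrow> vnorm (f i) \<le> B" "0 \<le> B"
  shows "vnorm (sum f A) \<le> B"
  using assms
proof (induction A rule: infinite_finite_induct)
  case (insert i A)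
  then show ?case
    using vnorm_ultra[of "f i" "sum f A"] by (auto intro: order_trans)
qed auto

lemma na_LIMSEQ_iff:
  fixes X :: "nat \<Rightarrow> 'k::nonarch_normed"
  shows "X \<longlonglongrightarrow> L \<longleftrightarrow> (\<lambda>n. vnorm (X n - L)) \<longlonglongrightarrow> 0"
  by (subst tendsto_dist_iff) (simp add: dist_vnorm)

lemma na_tendsto_add:
  fixes X Y :: "nat \<Rightarrow> 'k::nonarch_normed"
  assumes "X \<longlonglongrightarrow> a" "Y \<longlonglongrightarrow> b"
  shows "(\<lambda>n. X n + Y n) \<longlonglongrightarrow> a + b"
proof -
  have "(\<lambda>n. vnorm (X n - a) + vnorm (Y n - b)) \<longlonglongrightarrow> 0 + 0"
    using assms unfolding na_LIMSEQ_iff[of X] na_LIMSEQ_iff[of Y] by (rule tendsto_add)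
  moreover have "dist (X n + Y n) (a + b) \<le> dist (vnorm (X n - a) + vnorm (Y n - b)) (0 + 0)" for n
    using vnorm_triangle[of "X n - a" "Y n - b"] vnorm_nonneg[of "X n - a"] vnorm_nonneg[of "Y n - b"]
    by (simp add: dist_vnorm dist_real_def algebra_simps)
  ultimately show ?thesis
    by (intro metric_tendsto_imp_tendsto[of _ _ sequentially "\<lambda>n. X n + Y n"] always_eventually allI)
qed

lemma na_tendsto_cmult:
  fixes X :: "nat \<Rightarrow> 'k::nonarch_valued_field"
  assumes "X \<longlonglongrightarrow> a"
  shows "(\<lambda>n. c * X n) \<longlonglongrightarrow> c * a"
proof -
  have "(\<lambda>n. vnorm c * vnorm (X n - a)) \<longlonglongrightarrow> vnorm c * 0"
    using assms unfolding na_LIMSEQ_iff[of X] by (rule tendsto_mult_left)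
  then show ?thesis
    unfolding na_LIMSEQ_iff[of "\<lambda>n. c * X n"]
    by (simp add: vnorm_mult flip: right_diff_distrib)
qed

lemma na_tendsto_norm:
  fixes X :: "nat \<Rightarrow> 'k::nonarch_normed"
  assumes "X \<longlonglongrightarrow> a"
  shows "(\<lambda>n. vnorm (X n)) \<longlonglongrightarrow> vnorm a"
  unfolding vnorm_dist0 by (rule tendsto_dist[OF assms tendsto_const])

lemma na_summable:
  fixes f :: "nat \<Rightarrow> 'k::complete_valued_field"
  assumes "f \<longlonglongrightarrow> 0"
  shows "summable f"
proof -
  have "Cauchy (\<lambda>n. sum f {..<n})"
  proof (rule metric_CauchyI)
    fix e :: real assume "0 < e"
    then obtain N where N: "\<And>n. n \<ge> N \<Longrightarrow> vnorm (f n) < e / 2"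
      using assms[unfolded lim_sequentially, rule_format, of "e / 2"]
      by (auto simp: dist_vnorm)
    have *: "dist (sum f {..<m}) (sum f {..<n}) < e" if "N \<le> n" "n \<le> m" for m n
    proof -
      have "sum f {..<m} - sum f {..<n} = sum f {n..<m}"
        using that by (metis lessThan_atLeast0 sum_diff_nat_ivl zero_le)
      moreover have "vnorm (sum f {n..<m}) \<le> e / 2"
        using that N \<open>0 < e\<close> by (intro vnorm_sum_le) (auto simp: less_imp_le)
      ultimately show ?thesis using \<open>0 < e\<close> by (simp add: dist_vnorm)
    qed
    show "\<exists>M. \<forall>m\<ge>M. \<forall>n\<ge>M. dist (sum f {..<m}) (sum f {..<n}) < e"
      by (metis * dist_commute nle_le)
  qed
  then have "convergent (\<lambda>n. sum f {..<n})"
    by (simp add: Cauchy_convergent)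
  then show ?thesis
    by (simp add: summable_iff_convergent)
qed


section \<open>The Banach space \<open>c\<^sub>0\<close>\<close>

typedef (overloaded) 'k c0 = "{x :: nat \<Rightarrow> 'k::nonarch_valued_field. x \<longlonglongrightarrow> 0}"
  morphisms c0_nth Abs_c0
  by (intro exI[of _ "\<lambda>_. 0"]) simp

setup_lifting type_definition_c0

instantiation c0 :: (nonarch_valued_field) ab_group_add
begin

lift_definition zero_c0 :: "'a c0" is "\<lambda>_. 0" by simp

lift_definition plus_c0 :: "'a c0 \<Rightarrow> 'a c0 \<Rightarrow> 'a c0" is "\<lambda>x y n. x n + y n"
  using na_tendsto_add[where a = 0 and b = 0] by simp

lift_definition uminus_c0 :: "'a c0 \<Rightarrow> 'a c0" is "\<lambda>x n. - x n"
  using na_tendsto_cmult[where a = 0 and c = "-1"] by simp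

definition minus_c0 :: "'a c0 \<Rightarrow> 'a c0 \<Rightarrow> 'a c0" where "x - y = x + - (y :: 'a c0)"

instance
  by standard (transfer, auto simp: algebra_simps minus_c0_def)+

end

lift_definition scale_c0 :: "'k::nonarch_valued_field \<Rightarrow> 'k c0 \<Rightarrow> 'k c0" is "\<lambda>c x n. c * x n"
  using na_tendsto_cmult[where a = 0] by simp

lemma vector_space_c0: "vector_space scale_c0"
  by standard (transfer, auto simp: algebra_simps)+

lemma c0_nth_simps [simp]:
  "c0_nth 0 n = 0" "c0_nth (x + y) n = c0_nth x n + c0_nth y n"
  "c0_nth (- x) n = - c0_nth x n" "c0_nth (x - y) n = c0_nth x n - c0_nth y n"
  "c0_nth (scale_c0 c x) n = c * c0_nth x n"
  by (simp_all only: zero_c0.rep_eq plus_c0.rep_eq uminus_c0.rep_eq scale_c0.rep_eq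
        diff_conv_add_uminus)

lemma c0_nth_tendsto: "c0_nth x \<longlonglongrightarrow> 0"
  using c0_nth[of x] by simp

lemma c0_eqI: "(\<And>n. c0_nth x n = c0_nth y n) \<Longrightarrow> x = y"
  by (metis c0_nth_inject ext)

instantiation c0 :: (nonarch_valued_field) nonarch_normed
begin

definition vnorm_c0 :: "'a c0 \<Rightarrow> real" where
  "vnorm x = (SUP n. vnorm (c0_nth x n))"

definition dist_c0 :: "'a c0 \<Rightarrow> 'a c0 \<Rightarrow> real" where
  "dist x y = vnorm (x - y :: 'a c0)"

definition uniformity_c0 :: "('a c0 \<times> 'a c0) filter" where
  "uniformity_c0 = (INF e\<in>{0<..}. principal {(x, y). dist x y < e})"

definition open_c0 :: "'a c0 set \<Rightarrow> bool" where
  "open_c0 U \<longleftrightarrow> (\<forall>x\<in>U. \<forall>\<^sub>F (x', y) in uniformity. x' = x \<longrightarrow> y \<in> U)"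

lemma bdd_c0: "bdd_above (range (\<lambda>n. vnorm (c0_nth (x :: 'a c0) n)))"
proof -
  have "(\<lambda>n. vnorm (c0_nth x n)) \<longlonglongrightarrow> vnorm (0::'a)"
    by (intro na_tendsto_norm c0_nth_tendsto)
  then show ?thesis
    by (intro bounded_imp_bdd_above convergent_imp_bounded)
qed

lemma vnorm_nth_le: "vnorm (c0_nth x n) \<le> vnorm (x :: 'a c0)"
  unfolding vnorm_c0_def by (intro cSUP_upper bdd_c0) auto

lemma vnorm_c0_leI: "(\<And>n. vnorm (c0_nth x n) \<le> B) \<Longrightarrow> vnorm (x :: 'a c0) \<le> B"
  unfolding vnorm_c0_def by (intro cSUP_least) auto

lemma vnorm_c0_nonneg: "0 \<le> vnorm (x :: 'a c0)"
  using vnorm_nth_le[of x 0] vnorm_nonneg order_trans by blast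

lemma vnorm_c0_eq_zero: "vnorm (x :: 'a c0) = 0 \<longleftrightarrow> x = 0"
proof
  assume "vnorm x = 0"
  then have "vnorm (c0_nth x n) = 0" for n
    using vnorm_nth_le[of x n] vnorm_nonneg[of "c0_nth x n"] by linarith
  then show "x = 0" by (intro c0_eqI) simp
next
  assume "x = 0"
  then have "vnorm x \<le> 0" by (intro vnorm_c0_leI) simp
  then show "vnorm x = 0" using vnorm_c0_nonneg[of x] by simp
qed

lemma vnorm_c0_ultra: "vnorm (x + y) \<le> max (vnorm x) (vnorm (y :: 'a c0))"
proof (rule vnorm_c0_leI)
  fix n
  have "vnorm (c0_nth x n + c0_nth y n) \<le> max (vnorm (c0_nth x n)) (vnorm (c0_nth y n))"
    by (rule vnorm_ultra)
  also have "\<dots> \<le> max (vnorm x) (vnorm y)"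
    using vnorm_nth_le[of x n] vnorm_nth_le[of y n] by linarith
  finally show "vnorm (c0_nth (x + y) n) \<le> max (vnorm x) (vnorm y)" by simp
qed

lemma vnorm_c0_minus: "vnorm (- x) = vnorm (x :: 'a c0)"
  by (simp add: vnorm_c0_def)

instance
proof
  fix x y z :: "'a c0"
  show "dist x y = 0 \<longleftrightarrow> x = y"
    by (simp add: dist_c0_def vnorm_c0_eq_zero)
  have "vnorm (x - y) \<le> max (vnorm (x - z)) (vnorm (- (y - z)))"
    using vnorm_c0_ultra[of "x - z" "- (y - z)"] by (simp add: algebra_simps)
  then show "dist x y \<le> dist x z + dist y z"
    using vnorm_c0_nonneg[of "x - z"] vnorm_c0_nonneg[of "y - z"]
    unfolding dist_c0_def vnorm_c0_minus by linarith
qed (simp_all add: dist_c0_def vnorm_c0_ultra uniformity_c0_def open_c0_def)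

end

lemma vnorm_scale_c0_le: "vnorm (scale_c0 c x) \<le> vnorm c * vnorm x"
  by (intro vnorm_c0_leI) (simp add: vnorm_mult mult_left_mono vnorm_nth_le)

definition inner_c0 :: "'k::complete_valued_field c0 \<Rightarrow> 'k c0 \<Rightarrow> 'k" where
  "inner_c0 x y = (\<Sum>n. c0_nth x n * c0_nth y n)"

lemma tendsto_mult_c0:
  fixes x y :: "'k::nonarch_valued_field c0"
  shows "(\<lambda>n. c0_nth x n * c0_nth y n) \<longlonglongrightarrow> 0"
proof -
  have "(\<lambda>n. vnorm (c0_nth x n) * vnorm (c0_nth y n)) \<longlonglongrightarrow> vnorm (0::'k) * vnorm (0::'k)"
    by (intro tendsto_mult na_tendsto_norm c0_nth_tendsto)
  then show ?thesis
    unfolding na_LIMSEQ_iff[of "\<lambda>n. c0_nth x n * c0_nth y n"] by (simp add: vnorm_mult)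
qed

lemma inner_c0_sums: "(\<lambda>n. c0_nth x n * c0_nth y n) sums inner_c0 x y"
  unfolding inner_c0_def by (intro summable_sums na_summable tendsto_mult_c0)

lemma inner_c0_add: "inner_c0 (x + x') y = inner_c0 x y + inner_c0 x' y"
proof -
  have "(\<lambda>n. c0_nth (x + x') n * c0_nth y n) sums (inner_c0 x y + inner_c0 x' y)"
    using na_tendsto_add[OF inner_c0_sums[of x y, unfolded sums_def]
                            inner_c0_sums[of x' y, unfolded sums_def]]
    by (simp add: sums_def distrib_right sum.distrib)
  then show ?thesis using inner_c0_sums sums_unique2 by blast
qed

lemma inner_c0_scale: "inner_c0 (scale_c0 c x) y = c * inner_c0 x y"
proof -
  have "(\<lambda>n. c0_nth (scale_c0 c x) n * c0_nth y n) sums (c * inner_c0 x y)"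
    using na_tendsto_cmult[OF inner_c0_sums[of x y, unfolded sums_def], of c]
    by (simp add: sums_def sum_distrib_left mult.assoc)
  then show ?thesis using inner_c0_sums sums_unique2 by blast
qed

lemma vnorm_inner_c0_le: "vnorm (inner_c0 x y) \<le> vnorm x * vnorm y"
proof (rule LIMSEQ_le_const2)
  show "(\<lambda>n. vnorm (\<Sum>i<n. c0_nth x i * c0_nth y i)) \<longlonglongrightarrow> vnorm (inner_c0 x y)"
    using inner_c0_sums[of x y] unfolding sums_def by (rule na_tendsto_norm)
  show "\<exists>N. \<forall>n\<ge>N. vnorm (\<Sum>i<n. c0_nth x i * c0_nth y i) \<le> vnorm x * vnorm y"
    by (intro exI allI impI vnorm_sum_le)
       (auto simp: vnorm_mult intro!: mult_mono vnorm_nth_le vnorm_c0_nonneg)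
qed


section \<open>Bounded linear operators on \<open>c\<^sub>0\<close> with the operator norm\<close>

definition bounded_linear_c0 :: "('k::nonarch_valued_field c0 \<Rightarrow> 'k c0) \<Rightarrow> bool" where
  "bounded_linear_c0 T \<longleftrightarrow>
     Vector_Spaces.linear scale_c0 scale_c0 T \<and> (\<exists>B. \<forall>x. vnorm (T x) \<le> B * vnorm x)"

lemma linear_c0_iff:
  "Vector_Spaces.linear scale_c0 scale_c0 T \<longleftrightarrow>
     (\<forall>x y. T (x + y) = T x + T y) \<and> (\<forall>c x. T (scale_c0 c x) = scale_c0 c (T x))"
  unfolding Vector_Spaces.linear_def module_hom_axioms_def module_hom_def
  using vector_space_c0 module_iff_vector_space by blast

lemma bounded_linear_c0I:
  assumes "\<And>x y. T (x + y) = T x + T y" "\<And>c x. T (scale_c0 c x) = scale_c0 c (T x)"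
    and "\<And>x. vnorm (T x) \<le> B * vnorm x"
  shows "bounded_linear_c0 T"
  using assms unfolding bounded_linear_c0_def linear_c0_iff by blast

lemma bounded_linear_c0D:
  assumes "bounded_linear_c0 T"
  shows "T (x + y) = T x + T y" "T (scale_c0 c x) = scale_c0 c (T x)"
    "\<exists>B. \<forall>x. vnorm (T x) \<le> B * vnorm x"
  using assms unfolding bounded_linear_c0_def linear_c0_iff by blast+

lemma scale_c0_simps:
  "scale_c0 c (x + y) = scale_c0 c x + scale_c0 c y"
  "scale_c0 c (- x) = - scale_c0 c x"
  "scale_c0 c (0 :: 'k::nonarch_valued_field c0) = 0"
  "scale_c0 c (scale_c0 d x) = scale_c0 (c * d) x"
  "scale_c0 (c + d) x = scale_c0 c x + scale_c0 d x"
  by (rule c0_eqI; simp add: algebra_simps)+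

typedef (overloaded) 'k bop = "{T :: 'k::nonarch_valued_field c0 \<Rightarrow> 'k c0. bounded_linear_c0 T}"
  morphisms bop_apply Abs_bop
  by (intro exI[of _ "\<lambda>x. x"] CollectI bounded_linear_c0I[where B = 1]) simp_all

setup_lifting type_definition_bop

instantiation bop :: (nonarch_valued_field) ab_group_add
begin

lift_definition zero_bop :: "'a bop" is "\<lambda>_. 0"
  by (rule bounded_linear_c0I[where B = 0]) (simp_all add: scale_c0_simps)

lift_definition plus_bop :: "'a bop \<Rightarrow> 'a bop \<Rightarrow> 'a bop" is "\<lambda>S T x. S x + T x"
proof -
  fix S T :: "'a c0 \<Rightarrow> 'a c0"
  assume S: "bounded_linear_c0 S" and T: "bounded_linear_c0 T"
  obtain B C where B: "\<And>x. vnorm (S x) \<le> B * vnorm x" "\<And>x. vnorm (T x) \<le> C * vnorm x"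
    using bounded_linear_c0D(3)[OF S] bounded_linear_c0D(3)[OF T] by blast
  have "vnorm (S x + T x) \<le> (B + C) * vnorm x" for x
    using vnorm_triangle[of "S x" "T x"] B[of x] by (simp add: distrib_right)
  then show "bounded_linear_c0 (\<lambda>x. S x + T x)"
    by (rule bounded_linear_c0I[rotated 2])
       (simp_all add: bounded_linear_c0D[OF S] bounded_linear_c0D[OF T] scale_c0_simps add_ac)
qed

lift_definition uminus_bop :: "'a bop \<Rightarrow> 'a bop" is "\<lambda>T x. - T x"
proof -
  fix T :: "'a c0 \<Rightarrow> 'a c0"
  assume T: "bounded_linear_c0 T"
  obtain B where B: "\<And>x. vnorm (T x) \<le> B * vnorm x"
    using bounded_linear_c0D(3)[OF T] by blast
  have "vnorm (- T x) \<le> B * vnorm x" for x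
    using B[of x] by simp
  then show "bounded_linear_c0 (\<lambda>x. - T x)"
    by (rule bounded_linear_c0I[rotated 2])
       (simp_all add: bounded_linear_c0D[OF T] scale_c0_simps)
qed

definition minus_bop :: "'a bop \<Rightarrow> 'a bop \<Rightarrow> 'a bop" where "S - T = S + - (T :: 'a bop)"

instance
proof
  fix a b c :: "'a bop"
  show "a + b + c = a + (b + c)" by transfer (simp add: add.assoc)
  show "a + b = b + a" by transfer (simp add: add.commute)
  show "0 + a = a" by transfer simp
  show "- a + a = 0" by transfer simp
  show "a - b = a + - b" by (simp add: minus_bop_def)
qed

end

lift_definition id_bop :: "'k::nonarch_valued_field bop" is "\<lambda>x. x"
  by (rule bounded_linear_c0I[where B = 1]) simp_all

lift_definition scale_bop :: "'k::nonarch_valued_field \<Rightarrow> 'k bop \<Rightarrow> 'k bop"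
  is "\<lambda>c T x. scale_c0 c (T x)"
proof -
  fix c :: 'k and T :: "'k c0 \<Rightarrow> 'k c0"
  assume T: "bounded_linear_c0 T"
  then obtain B where B: "\<And>x. vnorm (T x) \<le> B * vnorm x"
    using bounded_linear_c0D(3) by blast
  have "vnorm (scale_c0 c (T x)) \<le> (vnorm c * B) * vnorm x" for x
    using vnorm_scale_c0_le[of c "T x"] mult_left_mono[OF B[of x] vnorm_nonneg[of c]]
    by (simp add: mult.assoc)
  then show "bounded_linear_c0 (\<lambda>x. scale_c0 c (T x))"
    by (rule bounded_linear_c0I[rotated 2])
       (simp_all add: bounded_linear_c0D[OF T] scale_c0_simps mult.commute)
qed

lemma bop_apply_simps [simp]:
  "bop_apply 0 x = 0" "bop_apply (S + T) x = bop_apply S x + bop_apply T x"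
  "bop_apply (- T) x = - bop_apply T x" "bop_apply (S - T) x = bop_apply S x - bop_apply T x"
  "bop_apply id_bop x = x" "bop_apply (scale_bop c T) x = scale_c0 c (bop_apply T x)"
  by (simp_all only: zero_bop.rep_eq plus_bop.rep_eq uminus_bop.rep_eq id_bop.rep_eq
        scale_bop.rep_eq diff_conv_add_uminus)

lemma bop_eqI: "(\<And>x. bop_apply S x = bop_apply T x) \<Longrightarrow> S = T"
  by (metis bop_apply_inject ext)

lemma bop_apply_zero [simp]: "bop_apply T 0 = 0"
proof -
  have "bop_apply T (0 + 0) = bop_apply T 0 + bop_apply T 0"
    using bop_apply[of T] by (simp only: mem_Collect_eq bounded_linear_c0D)
  then show ?thesis by simp
qed

instantiation bop :: (nonarch_valued_field) nonarch_normed
begin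

text \<open>As in \<^const>\<open>onorm\<close>, the argument \<open>x = 0\<close> contributes the value \<open>0 / 0 = 0\<close>.\<close>

definition vnorm_bop :: "'a bop \<Rightarrow> real" where
  "vnorm T = (SUP x. vnorm (bop_apply T x) / vnorm x)"

definition dist_bop :: "'a bop \<Rightarrow> 'a bop \<Rightarrow> real" where
  "dist S T = vnorm (S - T :: 'a bop)"

definition uniformity_bop :: "('a bop \<times> 'a bop) filter" where
  "uniformity_bop = (INF e\<in>{0<..}. principal {(S, T). dist S T < e})"

definition open_bop :: "'a bop set \<Rightarrow> bool" where
  "open_bop U \<longleftrightarrow> (\<forall>S\<in>U. \<forall>\<^sub>F (S', T) in uniformity. S' = S \<longrightarrow> T \<in> U)"

lemma bdd_bop: "bdd_above (range (\<lambda>x. vnorm (bop_apply (T :: 'a bop) x) / vnorm x))"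
proof -
  obtain B where B: "\<And>x. vnorm (bop_apply T x) \<le> B * vnorm x"
    using bop_apply[of T] bounded_linear_c0D(3) by blast
  have "vnorm (bop_apply T x) / vnorm x \<le> max B 0" for x
  proof (cases "x = 0")
    case False
    then have "0 < vnorm x" by (rule vnorm_pos)
    then have "vnorm (bop_apply T x) / vnorm x \<le> B" using B[of x] by (simp add: divide_le_eq)
    then show ?thesis by simp
  qed (simp add: vnorm_c0_eq_zero)
  then show ?thesis by (rule bdd_aboveI2)
qed

lemma vnorm_bop_apply_le: "vnorm (bop_apply T x) \<le> vnorm (T :: 'a bop) * vnorm x"
proof (cases "x = 0")
  case False
  then have "0 < vnorm x" by (rule vnorm_pos)
  moreover have "vnorm (bop_apply T x) / vnorm x \<le> vnorm T"
    unfolding vnorm_bop_def by (intro cSUP_upper bdd_bop) auto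
  ultimately show ?thesis by (simp add: divide_le_eq)
qed (simp add: vnorm_c0_eq_zero)

lemma vnorm_bop_nonneg: "0 \<le> vnorm (T :: 'a bop)"
proof -
  have "vnorm (bop_apply T 0) / vnorm (0::'a c0) \<le> vnorm T"
    unfolding vnorm_bop_def by (intro cSUP_upper bdd_bop) auto
  then show ?thesis by (simp add: vnorm_c0_eq_zero)
qed

lemma vnorm_bop_leI:
  assumes "\<And>x. vnorm (bop_apply T x) \<le> B * vnorm x" "0 \<le> B"
  shows "vnorm (T :: 'a bop) \<le> B"
  unfolding vnorm_bop_def
proof (rule cSUP_least)
  fix x :: "'a c0"
  show "vnorm (bop_apply T x) / vnorm x \<le> B"
  proof (cases "x = 0")
    case False
    then have "0 < vnorm x" by (rule vnorm_pos)
    then show ?thesis using assms(1)[of x] by (simp add: divide_le_eq)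
  qed (simp add: vnorm_c0_eq_zero assms)
qed simp

lemma vnorm_bop_eq_zero: "vnorm (T :: 'a bop) = 0 \<longleftrightarrow> T = 0"
proof
  assume "vnorm T = 0"
  then have "vnorm (bop_apply T x) = 0" for x
    using vnorm_bop_apply_le[of T x] vnorm_c0_nonneg[of "bop_apply T x"] by simp
  then show "T = 0" by (intro bop_eqI) (simp add: vnorm_c0_eq_zero)
next
  assume "T = 0"
  then have "vnorm T \<le> 0" by (intro vnorm_bop_leI) (simp_all add: vnorm_c0_eq_zero)
  then show "vnorm T = 0" using vnorm_bop_nonneg[of T] by simp
qed

lemma vnorm_bop_ultra: "vnorm (S + T) \<le> max (vnorm S) (vnorm (T :: 'a bop))"
proof (rule vnorm_bop_leI)
  fix x
  have "vnorm (bop_apply S x + bop_apply T x) \<le> max (vnorm (bop_apply S x)) (vnorm (bop_apply T x))"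
    by (rule vnorm_c0_ultra)
  also have "\<dots> \<le> max (vnorm S * vnorm x) (vnorm T * vnorm x)"
    using vnorm_bop_apply_le[of S x] vnorm_bop_apply_le[of T x] by linarith
  also have "\<dots> = max (vnorm S) (vnorm T) * vnorm x"
    using vnorm_c0_nonneg[of x] by (simp add: max_mult_distrib_right)
  finally show "vnorm (bop_apply (S + T) x) \<le> max (vnorm S) (vnorm T) * vnorm x" by simp
qed (use vnorm_bop_nonneg[of S] in linarith)

lemma vnorm_bop_minus: "vnorm (- T) = vnorm (T :: 'a bop)"
  by (simp add: vnorm_bop_def vnorm_c0_minus)

instance
proof
  fix x y z :: "'a bop"
  show "dist x y = 0 \<longleftrightarrow> x = y"
    by (simp add: dist_bop_def vnorm_bop_eq_zero)
  have "vnorm (x - y) \<le> max (vnorm (x - z)) (vnorm (- (y - z)))"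
    using vnorm_bop_ultra[of "x - z" "- (y - z)"] by (simp add: algebra_simps)
  then show "dist x y \<le> dist x z + dist y z"
    using vnorm_bop_nonneg[of "x - z"] vnorm_bop_nonneg[of "y - z"]
    unfolding dist_bop_def vnorm_bop_minus by linarith
qed (simp_all add: dist_bop_def vnorm_bop_ultra uniformity_bop_def open_bop_def)

end


section \<open>Orthonormal sequences, projections and the algebra \<open>S\<^sub>Y\<close>\<close>

text \<open>Sequences are indexed by all of \<^typ>\<open>nat\<close>, starting with \<open>0\<close>.\<close>

definition orthonormal_seq :: "(nat \<Rightarrow> 'k::complete_valued_field c0) \<Rightarrow> bool" where
  "orthonormal_seq Y \<longleftrightarrow>
     (\<forall>i j. i \<noteq> j \<longrightarrow> inner_c0 (Y i) (Y j) = 0) \<and> (\<forall>i. vnorm (Y i) = 1)"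

lift_definition proj_along :: "'k::complete_valued_field c0 \<Rightarrow> 'k bop"
  is "\<lambda>y x. scale_c0 (inner_c0 x y / inner_c0 y y) y"
proof -
  fix y :: "'k c0"
  let ?P = "\<lambda>x. scale_c0 (inner_c0 x y / inner_c0 y y) y"
  have "vnorm (?P x) \<le> (vnorm y * vnorm (inverse (inner_c0 y y)) * vnorm y) * vnorm x" for x
  proof -
    have "vnorm (?P x) \<le> vnorm (inner_c0 x y / inner_c0 y y) * vnorm y"
      by (rule vnorm_scale_c0_le)
    also have "\<dots> = vnorm (inner_c0 x y) * vnorm (inverse (inner_c0 y y)) * vnorm y"
      by (simp add: divide_inverse vnorm_mult)
    also have "\<dots> \<le> (vnorm x * vnorm y) * vnorm (inverse (inner_c0 y y)) * vnorm y"
      by (intro mult_right_mono vnorm_inner_c0_le vnorm_c0_nonneg vnorm_nonneg)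
    finally show ?thesis by (simp add: mult_ac)
  qed
  then show "bounded_linear_c0 ?P"
    by (rule bounded_linear_c0I[rotated 2])
       (simp_all add: inner_c0_add inner_c0_scale add_divide_distrib scale_c0_simps)
qed

definition P_op :: "(nat \<Rightarrow> 'k::complete_valued_field c0) \<Rightarrow> nat \<Rightarrow> 'k bop" where
  "P_op Y i = proj_along (Y i)"

text \<open>The series converges in the operator norm.\<close>

definition T_op :: "(nat \<Rightarrow> 'k::complete_valued_field c0) \<Rightarrow> 'k c0 \<Rightarrow> 'k bop" where
  "T_op Y l = (\<Sum>i. scale_bop (c0_nth l i) (P_op Y i))"

definition S_alg :: "(nat \<Rightarrow> 'k::complete_valued_field c0) \<Rightarrow> 'k bop set" where
  "S_alg Y = {scale_bop a id_bop + T_op Y l | a l. True}"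


section \<open>The compactification, the measure and the integral\<close>

text \<open>The point at infinity is \<^const>\<open>None\<close>; the natural number \<open>n\<close> is \<open>Some n\<close>.\<close>

definition Nstar :: "nat option topology" where
  "Nstar = Alexandroff_compactification (discrete_topology UNIV)"

definition clopens :: "'a topology \<Rightarrow> 'a set set" where
  "clopens X = {C. openin X C \<and> closedin X C}"

text \<open>
  A clopen set containing \<^const>\<open>None\<close> has finite complement, one not containing it is finite,
  so on \<open>clopens Nstar\<close> both sums are finite. The value on other sets is irrelevant.
\<close>

definition proj_measure ::
  "(nat \<Rightarrow> 'k::complete_valued_field c0) \<Rightarrow> nat option set \<Rightarrow> 'k bop" where
  "proj_measure Y C =
     (if None \<in> C then id_bop - (\<Sum>n | Some n \<notin> C. P_op Y n)
      else (\<Sum>n | Some n \<in> C. P_op Y n))"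

text \<open>A tagged partition is the set of its pairs \<open>(C\<^sub>k, x\<^sub>k)\<close>.\<close>

definition tagged_partitions :: "'a topology \<Rightarrow> ('a set \<times> 'a) set set" where
  "tagged_partitions X =
     {\<alpha>. finite \<alpha> \<and> inj_on fst \<alpha> \<and> partition_on (topspace X) (fst ` \<alpha>) \<and>
         fst ` \<alpha> \<subseteq> clopens X \<and> (\<forall>(C, x)\<in>\<alpha>. x \<in> C)}"

text \<open>The filter of tails of the directed set of tagged partitions.\<close>

definition refinement_filter :: "'a topology \<Rightarrow> ('a set \<times> 'a) set filter" where
  "refinement_filter X =
     (INF \<alpha>\<in>tagged_partitions X.
        principal {\<beta> \<in> tagged_partitions X. refines (topspace X) (fst ` \<beta>) (fst ` \<alpha>)})"

definition riemann_sum ::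
  "('a set \<times> 'a) set \<Rightarrow> ('a \<Rightarrow> 'k) \<Rightarrow> ('a set \<Rightarrow> 'k bop) \<Rightarrow> 'k::nonarch_valued_field bop" where
  "riemann_sum \<alpha> f m = (\<Sum>(C, x)\<in>\<alpha>. scale_bop (f x) (m C))"

definition has_measure_integral ::
  "('a \<Rightarrow> 'k) \<Rightarrow> ('a set \<Rightarrow> 'k bop) \<Rightarrow> 'a topology \<Rightarrow> 'k::nonarch_valued_field bop \<Rightarrow> bool" where
  "has_measure_integral f m X H \<longleftrightarrow>
     ((\<lambda>\<alpha>. riemann_sum \<alpha> f m) \<longlongrightarrow> H) (refinement_filter X)"

lemma tagged_partition_exists:
  assumes "finite Q" "partition_on (topspace X) Q" "Q \<subseteq> clopens X"
  obtains \<alpha> where "\<alpha> \<in> tagged_partitions X" "fst ` \<alpha> = Q"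
proof -
  define \<alpha> where "\<alpha> = (\<lambda>C. (C, SOME x. x \<in> C)) ` Q"
  have img: "fst ` \<alpha> = Q" by (auto simp: \<alpha>_def image_image)
  have "C \<noteq> {}" if "C \<in> Q" for C
    using assms(2) that by (auto simp: partition_on_def)
  then have "\<alpha> \<in> tagged_partitions X"
    using assms img by (auto simp: tagged_partitions_def \<alpha>_def inj_on_def some_in_eq)
  with img that show ?thesis by blast
qed

lemma tagged_partitions_directed:
  assumes "\<alpha> \<in> tagged_partitions X" "\<beta> \<in> tagged_partitions X"
  obtains \<gamma> where "\<gamma> \<in> tagged_partitions X"
    "refines (topspace X) (fst ` \<gamma>) (fst ` \<alpha>)" "refines (topspace X) (fst ` \<gamma>) (fst ` \<beta>)"
proof -
  let ?Ps = "{fst ` \<alpha>, fst ` \<beta>}"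
  let ?Q = "common_refinement ?Ps"
  have P: "\<And>P. P \<in> ?Ps \<Longrightarrow> partition_on (topspace X) P"
    using assms by (auto simp: tagged_partitions_def)
  have "finite ?Q"
    using assms by (intro finite_common_refinement) (auto simp: tagged_partitions_def)
  moreover have "partition_on (topspace X) ?Q"
    using P by (intro partition_on_common_refinement) auto
  moreover have "?Q \<subseteq> clopens X"
  proof
    fix C assume "C \<in> ?Q"
    then obtain f where "f \<in> (\<Pi> P\<in>?Ps. P)" "C = \<Inter> (f ` ?Ps)"
      unfolding common_refinement by blast
    then have "f (fst ` \<alpha>) \<in> fst ` \<alpha>" "f (fst ` \<beta>) \<in> fst ` \<beta>"
      and C: "C = f (fst ` \<alpha>) \<inter> f (fst ` \<beta>)"
      by (simp_all only: Pi_iff ball_simps image_insert image_empty Inter_insert Inter_empty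
            Int_UNIV_right)
    then have "f (fst ` \<alpha>) \<in> clopens X" "f (fst ` \<beta>) \<in> clopens X"
      using assms unfolding tagged_partitions_def by blast+
    with C show "C \<in> clopens X" by (simp add: clopens_def openin_Int closedin_Int)
  qed
  ultimately obtain \<gamma> where "\<gamma> \<in> tagged_partitions X" "fst ` \<gamma> = ?Q"
    by (rule tagged_partition_exists)
  moreover have "refines (topspace X) ?Q P" if "P \<in> ?Ps" for P
    using P that by (rule refines_common_refinement)
  ultimately show ?thesis by (intro that[of \<gamma>]) simp_all
qed

lemma eventually_refinement_filter:
  assumes "topspace X \<noteq> {}"
  shows "eventually R (refinement_filter X) \<longleftrightarrow>
     (\<exists>\<alpha>\<in>tagged_partitions X. \<forall>\<beta>\<in>tagged_partitions X.
        refines (topspace X) (fst ` \<beta>) (fst ` \<alpha>) \<longrightarrow> R \<beta>)"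
proof -
  have "partition_on (topspace X) {topspace X}" "{topspace X} \<subseteq> clopens X"
    using assms unfolding partition_on_def clopens_def disjoint_def by blast+
  then obtain \<alpha>0 where "\<alpha>0 \<in> tagged_partitions X"
    by (rule tagged_partition_exists[OF finite.insertI[OF finite.emptyI]])
  then have ne: "tagged_partitions X \<noteq> {}"
    by blast
  show ?thesis
    unfolding refinement_filter_def
  proof (subst eventually_INF_base[OF ne])
    fix \<alpha> \<beta> assume "\<alpha> \<in> tagged_partitions X" "\<beta> \<in> tagged_partitions X"
    then obtain \<gamma> where "\<gamma> \<in> tagged_partitions X"
      "refines (topspace X) (fst ` \<gamma>) (fst ` \<alpha>)" "refines (topspace X) (fst ` \<gamma>) (fst ` \<beta>)"
      by (rule tagged_partitions_directed)
    then show "\<exists>\<gamma>\<in>tagged_partitions X.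
       principal {\<delta> \<in> tagged_partitions X. refines (topspace X) (fst ` \<delta>) (fst ` \<gamma>)}
       \<le> inf (principal {\<delta> \<in> tagged_partitions X. refines (topspace X) (fst ` \<delta>) (fst ` \<alpha>)})
             (principal {\<delta> \<in> tagged_partitions X. refines (topspace X) (fst ` \<delta>) (fst ` \<beta>)})"
      by (intro bexI[of _ \<gamma>]) (auto intro: refines_trans)
  qed (auto simp: eventually_principal)
qed

lemma refinement_filter_ne_bot:
  assumes "topspace X \<noteq> {}"
  shows "refinement_filter X \<noteq> bot"
proof
  assume "refinement_filter X = bot"
  then have "eventually (\<lambda>_. False) (refinement_filter X)" by simp
  then obtain \<alpha> where \<alpha>: "\<alpha> \<in> tagged_partitions X"
    and no: "\<And>\<beta>. \<beta> \<in> tagged_partitions X \<Longrightarrow> \<not> refines (topspace X) (fst ` \<beta>) (fst ` \<alpha>)"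
    unfolding eventually_refinement_filter[OF assms] by blast
  have "refines (topspace X) (fst ` \<alpha>) (fst ` \<alpha>)"
    using \<alpha> unfolding tagged_partitions_def by (blast intro: refines_refl)
  with no[OF \<alpha>] show False by contradiction
qed

lemma topspace_Nstar: "topspace Nstar = UNIV"
  by (auto simp: Nstar_def UNIV_option_conv)

lemma has_measure_integral_unique:
  assumes "has_measure_integral f m X H" "has_measure_integral f m X H'" "topspace X \<noteq> {}"
  shows "H = H'"
  using assms tendsto_unique[OF refinement_filter_ne_bot[of X]]
  unfolding has_measure_integral_def by blast

end

theory Submission
  imports Defs
begin

text \<open>
  For \<open>H = a Id + \<Sum> \<lambda>\<^sub>i P\<^sub>i\<close> take \<open>f(i) = a + \<lambda>\<^sub>i\<close> and \<open>f = a\<close> at the point at infinity. Formal reality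
  of the residue field forbids cancellation among leading terms in \<open>\<Sum> y\<^sub>n\<^sup>2\<close>, so \<open>\<bar>\<langle>y,y\<rangle>\<bar> = 1\<close> for
  unit vectors; hence every \<open>P\<^sub>i\<close>, and every value of the measure, has norm at most \<open>1\<close>. A partition
  that isolates the points \<open>i < N\<close> then has Riemann sum
  \<open>a Id + \<Sum>\<^sub>i\<^sub><\<^sub>N \<lambda>\<^sub>i P\<^sub>i + \<Sum> (f(x\<^sub>k) - a) m(C\<^sub>k)\<close>, where the last sum runs over the remaining cells.
  By the ultrametric inequality that sum is at most \<open>sup {\<bar>\<lambda>\<^sub>i\<bar>. i \<ge> N}\<close> in norm, however many cells there are.
\<close>

section \<open>Sums of squares and formally real residue fields\<close>

lemma cring_valuation_ring: "cring (valuation_ring :: 'k::nonarch_valued_field ring)"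
proof (rule cringI)
  show "abelian_group (valuation_ring :: 'k ring)"
  proof (rule abelian_groupI)
    fix x y :: 'k
    assume "x \<in> carrier valuation_ring" "y \<in> carrier valuation_ring"
    then show "x \<oplus>\<^bsub>valuation_ring\<^esub> y \<in> carrier valuation_ring"
      using vnorm_ultra[of x y] by (simp add: valuation_ring_def)
  next
    fix x :: 'k
    assume "x \<in> carrier valuation_ring"
    then show "\<exists>y\<in>carrier valuation_ring. y \<oplus>\<^bsub>valuation_ring\<^esub> x = \<zero>\<^bsub>valuation_ring\<^esub>"
      by (intro bexI[of _ "- x"]) (simp_all add: valuation_ring_def)
  qed (simp_all add: valuation_ring_def algebra_simps)
  show "Group.comm_monoid (valuation_ring :: 'k ring)"
    by (rule comm_monoidI) (simp_all add: valuation_ring_def vnorm_mult mult_le_one)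
qed (simp add: valuation_ring_def algebra_simps)

lemma ideal_valuation_ring:
  "ideal {x. vnorm x < 1} (valuation_ring :: 'k::nonarch_valued_field ring)"
proof (rule idealI)
  interpret cring "valuation_ring :: 'k ring" by (rule cring_valuation_ring)
  show "ring (valuation_ring :: 'k ring)" by (rule ring_axioms)
  have uminus: "\<ominus>\<^bsub>valuation_ring\<^esub> x = - x" if "vnorm x < 1" for x :: 'k
    using that by (intro minus_equality) (simp_all add: valuation_ring_def)
  show "subgroup {x. vnorm x < 1} (add_monoid (valuation_ring :: 'k ring))"
  proof (rule add.subgroupI)
    show "{x. vnorm x < 1} \<subseteq> carrier (valuation_ring :: 'k ring)"
      by (auto simp: valuation_ring_def)
    show "{x :: 'k. vnorm x < 1} \<noteq> {}"
      by (auto intro: exI[of _ 0])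
  next
    fix x :: 'k assume "x \<in> {x. vnorm x < 1}"
    then show "\<ominus>\<^bsub>valuation_ring\<^esub> x \<in> {x. vnorm x < 1}"
      by (simp add: uminus)
  next
    fix x y :: 'k assume "x \<in> {x. vnorm x < 1}" "y \<in> {x. vnorm x < 1}"
    then show "x \<oplus>\<^bsub>valuation_ring\<^esub> y \<in> {x. vnorm x < 1}"
      using vnorm_ultra[of x y] by (simp add: valuation_ring_def)
  qed
  fix a x :: 'k
  assume *: "a \<in> {x. vnorm x < 1}" "x \<in> carrier valuation_ring"
  then have "vnorm x * vnorm a < 1"
    using mult_right_mono[of "vnorm x" 1 "vnorm a"] by (simp add: valuation_ring_def)
  then show "x \<otimes>\<^bsub>valuation_ring\<^esub> a \<in> {x. vnorm x < 1}" "a \<otimes>\<^bsub>valuation_ring\<^esub> x \<in> {x. vnorm x < 1}"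
    by (simp_all add: valuation_ring_def vnorm_mult mult.commute)
qed

text \<open>Formal reality speaks of sums in the ring structure, the norm estimates of sums in the
  field. This bridges the two; the induction works because partial sums stay in the unit
  ball.\<close>

lemma finsum_valuation_ring:
  fixes g :: "'i \<Rightarrow> 'k::nonarch_valued_field"
  assumes "finite A" "\<And>i. i \<in> A \<Longrightarrow> vnorm (g i) \<le> 1"
  shows "(\<Oplus>\<^bsub>valuation_ring\<^esub>i\<in>A. g i) = sum g A"
  using assms
proof (induction A)
  interpret cring "valuation_ring :: 'k ring" by (rule cring_valuation_ring)
  case empty
  show ?case unfolding finsum_empty by (simp add: valuation_ring_def)
next
  interpret cring "valuation_ring :: 'k ring" by (rule cring_valuation_ring)
  case (insert i A)
  have "(\<Oplus>\<^bsub>valuation_ring\<^esub>i\<in>insert i A. g i) = g i \<oplus>\<^bsub>valuation_ring\<^esub> (\<Oplus>\<^bsub>valuation_ring\<^esub>i\<in>A. g i)"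
    using insert by (intro finsum_insert) (auto simp: valuation_ring_def)
  then show ?case using insert by (simp add: valuation_ring_def)
qed

text \<open>Reduce modulo the maximal ideal: the residues of the \<open>a i\<close> have vanishing
  sum of squares, so formal reality makes each residue zero.\<close>

lemma sum_squares_residue:
  fixes a :: "nat \<Rightarrow> 'k::nonarch_valued_field"
  assumes real: "formally_real (residue_field :: 'k set ring)"
    and le: "\<And>i. i < n \<Longrightarrow> vnorm (a i) \<le> 1"
    and small: "vnorm (\<Sum>i<n. a i * a i) < 1"
    and "i < n"
  shows "vnorm (a i) < 1"
proof -
  let ?V = "valuation_ring :: 'k ring"
  let ?M = "{x :: 'k. vnorm x < 1}"
  let ?q = "(+>\<^bsub>?V\<^esub>) ?M"
  interpret ideal ?M ?V by (rule ideal_valuation_ring)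
  interpret q: ring_hom_cring ?V residue_field ?q
    unfolding residue_field_def by (rule rcos_ring_hom_cring[OF cring_valuation_ring])
  \<comment> \<open>The kernel of the quotient map is the open unit ball, so vanishing of a residue
    is a condition on the norm.\<close>
  have zero: "?q x = \<zero>\<^bsub>residue_field\<^esub> \<longleftrightarrow> vnorm x < 1" if "vnorm x \<le> 1" for x
    using that a_rcos_zero[OF ideal_axioms, of x] rcos_const_imp_mem[of x]
    by (auto simp: residue_field_def FactRing_def valuation_ring_def)
  have a: "a i \<in> carrier ?V" if "i < n" for i
    using le[OF that] by (simp add: valuation_ring_def)
  have sq: "vnorm (a i * a i) \<le> 1" if "i < n" for i
    using le[OF that] by (simp add: vnorm_mult mult_le_one)
  have "?q (\<Sum>i<n. a i * a i) = ?q (\<Oplus>\<^bsub>?V\<^esub>i\<in>{..<n}. a i * a i)"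
    using sq by (subst finsum_valuation_ring) auto
  also have "\<dots> = (\<Oplus>\<^bsub>residue_field\<^esub>i\<in>{..<n}. ?q (a i * a i))"
    using sq by (subst q.hom_finsum) (auto simp: valuation_ring_def o_def)
  also have "\<dots> = (\<Oplus>\<^bsub>residue_field\<^esub>i\<in>{..<n}. ?q (a i) \<otimes>\<^bsub>residue_field\<^esub> ?q (a i))"
  proof (rule q.S.finsum_cong')
    fix i assume "i \<in> {..<n}"
    then show "?q (a i * a i) = ?q (a i) \<otimes>\<^bsub>residue_field\<^esub> ?q (a i)"
      using q.hom_mult[OF a a, of i i] by (simp add: valuation_ring_def)
  qed (use a in auto)
  finally have "(\<Oplus>\<^bsub>residue_field\<^esub>i\<in>{..<n}. ?q (a i) \<otimes>\<^bsub>residue_field\<^esub> ?q (a i)) = \<zero>\<^bsub>residue_field\<^esub>"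
    using zero[of "\<Sum>i<n. a i * a i"] small by simp
  moreover have "(\<lambda>i. ?q (a i)) \<in> {..<n} \<rightarrow> carrier residue_field"
    using a by auto
  ultimately have "?q (a i) = \<zero>\<^bsub>residue_field\<^esub>"
    using real \<open>i < n\<close> unfolding formally_real_def by blast
  then show ?thesis using zero le \<open>i < n\<close> by blast
qed

text \<open>The norm is at most 1 by \<open>vnorm_inner_c0_le\<close>. Were it smaller, a long
  partial sum of squares would also have norm below 1. By \<open>sum_squares_residue\<close> the
  coordinates in that sum are then below 1, and the others are small anyway, so \<open>y\<close>
  could not have norm 1.\<close>

lemma vnorm_inner_c0_unit:
  fixes y :: "'k::complete_valued_field c0"
  assumes real: "formally_real (residue_field :: 'k set ring)" and y: "vnorm y = 1"
  shows "vnorm (inner_c0 y y) = 1"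
proof (rule ccontr)
  assume "vnorm (inner_c0 y y) \<noteq> 1"
  then have lt: "vnorm (inner_c0 y y) < 1"
    using vnorm_inner_c0_le[of y y] y by simp
  have "eventually (\<lambda>n. vnorm (c0_nth y n) < 1 / 2) sequentially"
    using tendstoD[OF c0_nth_tendsto, of "1 / 2" y] by (simp add: vnorm_dist0)
  moreover have "eventually (\<lambda>n. vnorm ((\<Sum>i<n. c0_nth y i * c0_nth y i) - inner_c0 y y) < 1) sequentially"
    using tendstoD[OF inner_c0_sums[of y y, unfolded sums_def], of 1] by (simp add: dist_vnorm)
  ultimately have "eventually (\<lambda>n. vnorm (c0_nth y n) < 1 / 2 \<and>
      vnorm ((\<Sum>i<n. c0_nth y i * c0_nth y i) - inner_c0 y y) < 1) sequentially"
    by (rule eventually_conj)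
  then obtain N where N: "\<And>n. n \<ge> N \<Longrightarrow> vnorm (c0_nth y n) < 1 / 2"
    and close: "vnorm ((\<Sum>i<N. c0_nth y i * c0_nth y i) - inner_c0 y y) < 1"
    unfolding eventually_sequentially by blast
  have "vnorm (\<Sum>i<N. c0_nth y i * c0_nth y i) < 1"
    using vnorm_ultra[of "(\<Sum>i<N. c0_nth y i * c0_nth y i) - inner_c0 y y" "inner_c0 y y"] close lt
    by simp
  moreover have "vnorm (c0_nth y i) \<le> 1" for i
    using vnorm_nth_le[of y i] y by simp
  ultimately have small: "vnorm (c0_nth y i) < 1" if "i < N" for i
    using sum_squares_residue[OF real] that by blast
  \<comment> \<open>Coordinates below 1 alone would still allow a supremum of 1; a maximum of
    finitely many of them does not. The entry 1/2 bounds the tail and keeps the set nonempty when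
    \<open>N\<close> is 0.\<close>
  define B where "B = Max (insert (1 / 2) ((\<lambda>i. vnorm (c0_nth y i)) ` {..<N}))"
  have "vnorm (c0_nth y n) \<le> B" for n
  proof (cases "n < N")
    case False
    then have "vnorm (c0_nth y n) \<le> 1 / 2" using N[of n] by simp
    then show ?thesis unfolding B_def by (auto simp: Max_ge_iff)
  qed (simp add: B_def)
  then have "vnorm y \<le> B" by (rule vnorm_c0_leI)
  moreover have "B < 1" using small by (simp add: B_def)
  ultimately show False using y by simp
qed

section \<open>Completeness of the operator space\<close>

text \<open>Closed balls are closed. This lets one index of a Cauchy estimate go to
  infinity.\<close>

lemma vnorm_diff_le_lim:
  fixes X :: "nat \<Rightarrow> 'a::nonarch_normed"
  assumes "X \<longlonglongrightarrow> L" "\<And>n. n \<ge> N \<Longrightarrow> vnorm (X n - a) \<le> B"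
  shows "vnorm (L - a) \<le> B"
proof -
  have "(\<lambda>n. dist (X n) a) \<longlonglongrightarrow> dist L a"
    by (intro tendsto_dist tendsto_const assms)
  then show ?thesis
    unfolding dist_vnorm by (rule LIMSEQ_le_const2) (use assms(2) in blast)
qed

lemma vnorm_diff_commute: "vnorm (x - y) = vnorm (y - x :: 'a::nonarch_normed)"
  by (metis dist_commute dist_vnorm)

lemma vnorm_CauchyD:
  assumes "Cauchy (X :: nat \<Rightarrow> 'a::nonarch_normed)" "0 < e"
  shows "\<exists>N. \<forall>m\<ge>N. \<forall>n\<ge>N. vnorm (X m - X n) < e"
  using assms unfolding Cauchy_def dist_vnorm by simp

text \<open>The limit is taken coordinatewise. The Cauchy estimate survives it uniformly in the
  coordinate, which shows both that the limit is a null sequence and that convergence holds in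
  norm.\<close>

instance c0 :: (complete_valued_field) complete_space
proof
  fix X :: "nat \<Rightarrow> 'a c0"
  assume X: "Cauchy X"
  have "Cauchy (\<lambda>n. c0_nth (X n) k)" for k
  proof (rule metric_CauchyI)
    fix e :: real assume "0 < e"
    then obtain N where "\<And>m n. m \<ge> N \<Longrightarrow> n \<ge> N \<Longrightarrow> vnorm (X m - X n) < e"
      using vnorm_CauchyD[OF X] by blast
    then show "\<exists>N. \<forall>m\<ge>N. \<forall>n\<ge>N. dist (c0_nth (X m) k) (c0_nth (X n) k) < e"
      using vnorm_nth_le[of "X _ - X _" k] unfolding dist_vnorm c0_nth_simps
      by (meson le_less_trans)
  qed
  then obtain z where z: "\<And>k. (\<lambda>n. c0_nth (X n) k) \<longlonglongrightarrow> z k"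
    unfolding Cauchy_convergent_iff convergent_def by metis
  have unif: "\<exists>N. \<forall>n\<ge>N. \<forall>k. vnorm (z k - c0_nth (X n) k) \<le> e" if "0 < e" for e
  proof -
    obtain N where N: "\<And>m n. m \<ge> N \<Longrightarrow> n \<ge> N \<Longrightarrow> vnorm (X m - X n) < e"
      using vnorm_CauchyD[OF X \<open>0 < e\<close>] by blast
    have "vnorm (z k - c0_nth (X n) k) \<le> e" if "n \<ge> N" for n k
    proof (rule vnorm_diff_le_lim[OF z])
      fix m assume "m \<ge> N"
      then show "vnorm (c0_nth (X m) k - c0_nth (X n) k) \<le> e"
        using vnorm_nth_le[of "X m - X n" k] N[of m n] that by simp
    qed
    then show ?thesis by blast
  qed
  have "z \<longlonglongrightarrow> 0"
  proof (rule metric_LIMSEQ_I)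
    fix e :: real assume "0 < e"
    then obtain n where n: "\<And>k. vnorm (z k - c0_nth (X n) k) \<le> e / 2"
      using unif[of "e / 2"] by auto
    obtain K where K: "\<And>k. k \<ge> K \<Longrightarrow> vnorm (c0_nth (X n) k) < e"
      using metric_LIMSEQ_D[OF c0_nth_tendsto \<open>0 < e\<close>, of "X n"] unfolding vnorm_dist0 by blast
    have "dist (z k) 0 < e" if "k \<ge> K" for k
      using vnorm_ultra[of "z k - c0_nth (X n) k" "c0_nth (X n) k"] n[of k] K[OF that] \<open>0 < e\<close>
      by (simp add: dist_vnorm)
    then show "\<exists>K. \<forall>k\<ge>K. dist (z k) 0 < e" by blast
  qed
  \<comment> \<open>\<open>Abs_c0 z\<close> has the coordinates \<open>z\<close> only because
    \<open>z\<close> is now known to be a null sequence.\<close>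
  then have nth: "c0_nth (Abs_c0 z) = z" by (simp add: Abs_c0_inverse)
  have "X \<longlonglongrightarrow> Abs_c0 z"
  proof (rule metric_LIMSEQ_I)
    fix e :: real assume "0 < e"
    then obtain N where N: "\<And>n k. n \<ge> N \<Longrightarrow> vnorm (z k - c0_nth (X n) k) \<le> e / 2"
      using unif[of "e / 2"] by auto
    have "vnorm (Abs_c0 z - X n) \<le> e / 2" if "n \<ge> N" for n
      using N[OF that] by (intro vnorm_c0_leI) (simp add: nth)
    then show "\<exists>N. \<forall>n\<ge>N. dist (X n) (Abs_c0 z) < e"
      using \<open>0 < e\<close> unfolding dist_vnorm vnorm_diff_commute[of "X _"]
      by (metis field_sum_of_halves le_less_trans less_add_same_cancel1 half_gt_zero)
  qed
  then show "convergent X" by (auto simp: convergent_def)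
qed

lemma tendsto_scale_c0:
  assumes "X \<longlonglongrightarrow> (x :: 'k::nonarch_valued_field c0)"
  shows "(\<lambda>n. scale_c0 c (X n)) \<longlonglongrightarrow> scale_c0 c x"
  unfolding na_LIMSEQ_iff
proof (rule tendsto_sandwich[OF _ _ tendsto_const])
  show "(\<lambda>n. vnorm c * vnorm (X n - x)) \<longlonglongrightarrow> 0"
    using assms unfolding na_LIMSEQ_iff by (rule tendsto_mult_right_zero)
  have "scale_c0 c (X n) - scale_c0 c x = scale_c0 c (X n - x)" for n
    by (rule c0_eqI) (simp add: algebra_simps)
  then show "\<forall>\<^sub>F n in sequentially. vnorm (scale_c0 c (X n) - scale_c0 c x) \<le> vnorm c * vnorm (X n - x)"
    by (simp add: vnorm_scale_c0_le)
qed simp_all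

lemma bop_linear:
  "bop_apply T (x + y) = bop_apply T x + bop_apply T y"
  "bop_apply T (scale_c0 c x) = scale_c0 c (bop_apply T x)"
  using bop_apply[of T] by (simp_all add: bounded_linear_c0D)

text \<open>Same scheme with pointwise limits, the estimates now being proportional to
  \<open>vnorm x\<close>. Completeness makes the series in \<open>T_op\<close> converge.\<close>

instance bop :: (complete_valued_field) complete_space
proof
  fix X :: "nat \<Rightarrow> 'a bop"
  assume X: "Cauchy X"
  have bound: "vnorm (bop_apply (X m) x - bop_apply (X n) x) \<le> vnorm (X m - X n) * vnorm x" for m n x
    using vnorm_bop_apply_le[of "X m - X n" x] by simp
  have "Cauchy (\<lambda>n. bop_apply (X n) x)" for x
  proof (rule metric_CauchyI)
    fix e :: real assume "0 < e"
    \<comment> \<open>The added 1 covers \<open>x = 0\<close>.\<close>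
    then have "0 < e / (vnorm x + 1)" by (simp add: add_nonneg_pos)
    then obtain N where N: "\<And>m n. m \<ge> N \<Longrightarrow> n \<ge> N \<Longrightarrow> vnorm (X m - X n) < e / (vnorm x + 1)"
      using vnorm_CauchyD[OF X] by blast
    have "vnorm (bop_apply (X m) x - bop_apply (X n) x) < e" if "m \<ge> N" "n \<ge> N" for m n
    proof -
      have "vnorm (bop_apply (X m) x - bop_apply (X n) x) \<le> e / (vnorm x + 1) * vnorm x"
        using bound[of m x n] mult_right_mono[OF less_imp_le[OF N[OF that]] vnorm_nonneg[of x]]
        by linarith
      also have "\<dots> < e"
        using \<open>0 < e\<close> vnorm_nonneg[of x] by (simp add: pos_divide_less_eq add_nonneg_pos)
      finally show ?thesis .
    qed
    then show "\<exists>N. \<forall>m\<ge>N. \<forall>n\<ge>N. dist (bop_apply (X m) x) (bop_apply (X n) x) < e"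
      unfolding dist_vnorm by blast
  qed
  then obtain S where S: "\<And>x. (\<lambda>n. bop_apply (X n) x) \<longlonglongrightarrow> S x"
    unfolding Cauchy_convergent_iff convergent_def by metis
  have unif: "\<exists>N. \<forall>n\<ge>N. \<forall>x. vnorm (S x - bop_apply (X n) x) \<le> e * vnorm x" if "0 < e" for e
  proof -
    obtain N where N: "\<And>m n. m \<ge> N \<Longrightarrow> n \<ge> N \<Longrightarrow> vnorm (X m - X n) < e"
      using vnorm_CauchyD[OF X \<open>0 < e\<close>] by blast
    have "vnorm (S x - bop_apply (X n) x) \<le> e * vnorm x" if "n \<ge> N" for n x
    proof (rule vnorm_diff_le_lim[OF S])
      fix m assume "m \<ge> N"
      then show "vnorm (bop_apply (X m) x - bop_apply (X n) x) \<le> e * vnorm x"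
        using bound[of m x n] mult_right_mono[OF less_imp_le[OF N[of m n]] vnorm_nonneg[of x]] that
        by linarith
    qed
    then show ?thesis by blast
  qed
  have "bounded_linear_c0 S"
  proof -
    \<comment> \<open>A single operator \<open>X n\<close> within distance 1 suffices to bound
      \<open>S\<close>.\<close>
    obtain n where n: "\<And>x. vnorm (S x - bop_apply (X n) x) \<le> 1 * vnorm x"
      using unif[of 1] by auto
    show ?thesis
    proof (rule bounded_linear_c0I)
      fix x y :: "'a c0"
      have "(\<lambda>n. bop_apply (X n) (x + y)) \<longlonglongrightarrow> S x + S y"
        unfolding bop_linear by (intro na_tendsto_add S)
      then show "S (x + y) = S x + S y" using S LIMSEQ_unique by blast
    next
      fix c :: 'a and x :: "'a c0"
      have "(\<lambda>n. bop_apply (X n) (scale_c0 c x)) \<longlonglongrightarrow> scale_c0 c (S x)"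
        unfolding bop_linear by (intro tendsto_scale_c0 S)
      then show "S (scale_c0 c x) = scale_c0 c (S x)" using S LIMSEQ_unique by blast
    next
      fix x
      show "vnorm (S x) \<le> (1 + vnorm (X n)) * vnorm x"
        using vnorm_triangle[of "S x - bop_apply (X n) x" "bop_apply (X n) x"] n[of x]
          vnorm_bop_apply_le[of "X n" x]
        by (simp add: distrib_right)
    qed
  qed
  then have app: "bop_apply (Abs_bop S) = S" by (simp add: Abs_bop_inverse)
  have "X \<longlonglongrightarrow> Abs_bop S"
  proof (rule metric_LIMSEQ_I)
    fix e :: real assume "0 < e"
    then obtain N where N: "\<And>n x. n \<ge> N \<Longrightarrow> vnorm (S x - bop_apply (X n) x) \<le> e / 2 * vnorm x"
      using unif[of "e / 2"] by auto
    have "vnorm (Abs_bop S - X n) \<le> e / 2" if "n \<ge> N" for n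
      using N[OF that] \<open>0 < e\<close> by (intro vnorm_bop_leI) (simp_all add: app)
    then show "\<exists>N. \<forall>n\<ge>N. dist (X n) (Abs_bop S) < e"
      using \<open>0 < e\<close> unfolding dist_vnorm vnorm_diff_commute[of "X _"]
      by (metis field_sum_of_halves le_less_trans less_add_same_cancel1 half_gt_zero)
  qed
  then show "convergent X" by (auto simp: convergent_def)
qed

text \<open>A block of the series is no larger than its largest term, so terms tending to 0 already
  give Cauchy partial sums. Stated for ultrametric groups in order to cover operators.\<close>

lemma nonarch_summable:
  fixes f :: "nat \<Rightarrow> 'a::{nonarch_normed, complete_space}"
  assumes "f \<longlonglongrightarrow> 0"
  shows "summable f"
proof -
  have "Cauchy (\<lambda>n. sum f {..<n})"
  proof (rule metric_CauchyI)
    fix e :: real assume "0 < e"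
    then obtain N where N: "\<And>n. n \<ge> N \<Longrightarrow> vnorm (f n) < e / 2"
      using metric_LIMSEQ_D[OF assms, of "e / 2"] unfolding vnorm_dist0 by auto
    have diff: "vnorm (sum f {..<n} - sum f {..<N}) \<le> e / 2" if "n \<ge> N" for n
    proof -
      have "sum f {..<n} - sum f {..<N} = sum f {N..<n}"
        using sum_diff_nat_ivl[of 0 N n f] that by (simp add: lessThan_atLeast0)
      moreover have "vnorm (sum f {N..<n}) \<le> e / 2"
        by (rule vnorm_sum_le) (use N \<open>0 < e\<close> in \<open>auto intro: less_imp_le\<close>)
      ultimately show ?thesis by simp
    qed
    \<comment> \<open>Both partial sums are compared with the one at \<open>N\<close>, so the order
      of \<open>m\<close> and \<open>n\<close> does not matter.\<close>
    have "dist (sum f {..<m}) (sum f {..<n}) < e" if "m \<ge> N" "n \<ge> N" for m n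
      using vnorm_ultra[of "sum f {..<m} - sum f {..<N}" "sum f {..<N} - sum f {..<n}"]
        diff[OF that(1)] diff[OF that(2)] \<open>0 < e\<close>
      by (simp add: dist_vnorm vnorm_diff_commute[of "sum f {..<N}"])
    then show "\<exists>N. \<forall>m\<ge>N. \<forall>n\<ge>N. dist (sum f {..<m}) (sum f {..<n}) < e" by blast
  qed
  then show ?thesis
    by (simp add: summable_iff_convergent Cauchy_convergent)
qed

lemma vnorm_suminf_tail:
  fixes f :: "nat \<Rightarrow> 'a::nonarch_normed"
  assumes "summable f" "\<And>n. n \<ge> N \<Longrightarrow> vnorm (f n) \<le> B" "0 \<le> B"
  shows "vnorm (suminf f - sum f {..<N}) \<le> B"
proof (rule vnorm_diff_le_lim)
  show "(\<lambda>n. sum f {..<n}) \<longlonglongrightarrow> suminf f"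
    using assms(1) summable_sums sums_def by blast
  fix n assume "n \<ge> N"
  then have "sum f {..<n} - sum f {..<N} = sum f {N..<n}"
    using sum_diff_nat_ivl[of 0 N n f] by (simp add: lessThan_atLeast0)
  then show "vnorm (sum f {..<n} - sum f {..<N}) \<le> B"
    using assms by (auto intro!: vnorm_sum_le)
qed

section \<open>Scalar multiples and projections\<close>

lemma scale_bop_add_left: "scale_bop (a + b) T = scale_bop a T + scale_bop b T"
  by (rule bop_eqI) (simp add: scale_c0_simps)

lemma scale_bop_add_right: "scale_bop a (S + T) = scale_bop a S + scale_bop a T"
  by (rule bop_eqI) (simp add: scale_c0_simps)

lemma scale_bop_zero_right [simp]: "scale_bop a 0 = 0"
  by (rule bop_eqI) (simp add: scale_c0_simps)

lemma scale_bop_sum_right: "scale_bop a (sum f A) = (\<Sum>i\<in>A. scale_bop a (f i))"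
  by (induction A rule: infinite_finite_induct) (simp_all add: scale_bop_add_right)

lemma vnorm_scale_bop_le: "vnorm (scale_bop a T) \<le> vnorm a * vnorm T"
proof (rule vnorm_bop_leI)
  fix x
  have "vnorm (bop_apply (scale_bop a T) x) \<le> vnorm a * vnorm (bop_apply T x)"
    by (simp add: vnorm_scale_c0_le)
  also have "\<dots> \<le> vnorm a * (vnorm T * vnorm x)"
    by (intro mult_left_mono vnorm_bop_apply_le vnorm_nonneg)
  finally show "vnorm (bop_apply (scale_bop a T) x) \<le> vnorm a * vnorm T * vnorm x"
    by (simp add: mult.assoc)
qed simp

text \<open>The denominator has norm 1 by \<open>vnorm_inner_c0_unit\<close>, so dividing by it
  leaves norms unchanged. Formal reality enters the operator estimates only here.\<close>

lemma vnorm_P_op_le: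
  fixes Y :: "nat \<Rightarrow> 'k::complete_valued_field c0"
  assumes "formally_real (residue_field :: 'k set ring)" "orthonormal_seq Y"
  shows "vnorm (P_op Y i) \<le> 1"
proof (rule vnorm_bop_leI)
  fix x
  have Y: "vnorm (Y i) = 1" using assms(2) by (simp add: orthonormal_seq_def)
  then have unit: "vnorm (inner_c0 (Y i) (Y i)) = 1" by (rule vnorm_inner_c0_unit[OF assms(1)])
  then have "inner_c0 (Y i) (Y i) \<noteq> 0" by auto
  then have "inner_c0 x (Y i) / inner_c0 (Y i) (Y i) * inner_c0 (Y i) (Y i) = inner_c0 x (Y i)"
    by simp
  then have "vnorm (inner_c0 x (Y i) / inner_c0 (Y i) (Y i)) = vnorm (inner_c0 x (Y i))"
    by (metis vnorm_mult unit mult_1_right)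
  moreover have "vnorm (bop_apply (P_op Y i) x)
      \<le> vnorm (inner_c0 x (Y i) / inner_c0 (Y i) (Y i)) * vnorm (Y i)"
    unfolding P_op_def proj_along.rep_eq by (rule vnorm_scale_c0_le)
  ultimately show "vnorm (bop_apply (P_op Y i) x) \<le> 1 * vnorm x"
    using vnorm_inner_c0_le[of x "Y i"] unfolding Y mult_1_right mult_1_left by linarith
qed simp

lemma vnorm_proj_measure_le:
  fixes Y :: "nat \<Rightarrow> 'k::complete_valued_field c0"
  assumes "formally_real (residue_field :: 'k set ring)" "orthonormal_seq Y"
  shows "vnorm (proj_measure Y C) \<le> 1"
proof -
  \<comment> \<open>The ultrametric bound does not grow with the number of terms. For infinite
    \<open>A\<close> the sum is 0 by convention, so \<open>C\<close> need not be clopen.\<close>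
  have sum: "vnorm (\<Sum>n\<in>A. P_op Y n) \<le> 1" for A
    by (intro vnorm_sum_le vnorm_P_op_le[OF assms]) simp
  have "vnorm (id_bop :: 'k bop) \<le> 1"
    by (intro vnorm_bop_leI) simp_all
  then have "vnorm (id_bop - (\<Sum>n\<in>A. P_op Y n)) \<le> 1" for A
    using sum[of A] vnorm_ultra[of "id_bop :: 'k bop" "- (\<Sum>n\<in>A. P_op Y n)"] by simp
  with sum show ?thesis by (simp add: proj_measure_def)
qed

section \<open>Partitions of the compactification\<close>

text \<open>Every set is closed in the discrete topology and the compact ones are the finite ones,
  so the neighbourhoods of infinity are the cofinite sets.\<close>

lemma openin_Nstar:
  "openin Nstar U \<longleftrightarrow> (None \<in> U \<longrightarrow> finite {n. Some n \<notin> U})"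
proof
  assume "openin Nstar U"
  then consider V where "U = Some ` V"
    | C where "finite C" "U = insert None (Some ` (UNIV - C))"
    unfolding Nstar_def openin_Alexandroff_compactification compactin_discrete_topology
      topspace_discrete_topology by blast
  then show "None \<in> U \<longrightarrow> finite {n. Some n \<notin> U}"
  proof cases
    case (2 C)
    then have "{n. Some n \<notin> U} = C" by auto
    with 2 show ?thesis by simp
  qed auto
next
  assume *: "None \<in> U \<longrightarrow> finite {n. Some n \<notin> U}"
  show "openin Nstar U"
  proof (cases "None \<in> U")
    case True
    have "x \<in> U \<longleftrightarrow> x \<in> insert None (Some ` (UNIV - {n. Some n \<notin> U}))" for x
      using True by (cases x) auto
    then have "U = insert None (Some ` (UNIV - {n. Some n \<notin> U}))" by blast
    then show ?thesis
      using * True unfolding Nstar_def openin_Alexandroff_compactification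
      by (intro disjI2 exI[of _ "{n. Some n \<notin> U}"]) (simp add: compactin_discrete_topology)
  next
    case False
    then have "x \<in> U \<longleftrightarrow> x \<in> Some ` {n. Some n \<in> U}" for x
      by (cases x) auto
    then have "U = Some ` {n. Some n \<in> U}" by blast
    then show ?thesis
      unfolding Nstar_def openin_Alexandroff_compactification by auto
  qed
qed

text \<open>Exactly one of \<open>C\<close> and its complement contains \<open>None\<close>;
  openness is a condition on that one only.\<close>

lemma clopens_Nstar:
  "C \<in> clopens Nstar \<longleftrightarrow> (if None \<in> C then finite {n. Some n \<notin> C} else finite {n. Some n \<in> C})"
  by (auto simp: clopens_def closedin_def topspace_Nstar openin_Nstar)

text \<open>Exactly one cell \<open>C0\<close> contains \<open>None\<close>. Its measure lacks the
  projections of the points outside \<open>C0\<close>, and these are precisely the points shared out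
  among the other cells.\<close>

lemma sum_proj_measure:
  assumes "finite Q" "partition_on UNIV Q" "Q \<subseteq> clopens Nstar"
  shows "(\<Sum>C\<in>Q. proj_measure Y C) = id_bop"
proof -
  have disj: "\<And>C D. C \<in> Q \<Longrightarrow> D \<in> Q \<Longrightarrow> C \<noteq> D \<Longrightarrow> C \<inter> D = {}" and UN: "\<Union>Q = UNIV"
    using assms(2) by (auto simp: partition_on_def disjoint_def)
  obtain C0 where C0: "C0 \<in> Q" "None \<in> C0"
    using UN UNIV_I[of None] by (metis UnionE)
  then have None: "None \<notin> C" if "C \<in> Q - {C0}" for C
    using disj that by blast
  have "Some n \<notin> C0 \<longleftrightarrow> (\<exists>C\<in>Q - {C0}. Some n \<in> C)" for n
  proof
    assume "Some n \<notin> C0"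
    moreover obtain C where "C \<in> Q" "Some n \<in> C"
      using UN UNIV_I[of "Some n"] by (metis UnionE)
    ultimately show "\<exists>C\<in>Q - {C0}. Some n \<in> C" by blast
  qed (use disj C0(1) in blast)
  then have "{n. Some n \<notin> C0} = (\<Union>C\<in>Q - {C0}. {n. Some n \<in> C})"
    by auto
  \<comment> \<open>Clopenness enters here: the sum over the union can be split because each piece
    is finite.\<close>
  moreover have "finite {n. Some n \<in> C}" if "C \<in> Q - {C0}" for C
    using assms(3) None[OF that] that by (auto simp: clopens_Nstar)
  moreover have "{n. Some n \<in> C} \<inter> {n. Some n \<in> D} = {}" if "C \<in> Q" "D \<in> Q" "C \<noteq> D" for C D
    using disj[OF that] by blast
  ultimately have
    "(\<Sum>n | Some n \<notin> C0. P_op Y n) = (\<Sum>C\<in>Q - {C0}. \<Sum>n | Some n \<in> C. P_op Y n)"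
    using assms(1) by (simp add: sum.UNION_disjoint)
  moreover have "(\<Sum>C\<in>Q. proj_measure Y C) = proj_measure Y C0 + (\<Sum>C\<in>Q - {C0}. proj_measure Y C)"
    by (rule sum.remove[OF assms(1) C0(1)])
  moreover have "(\<Sum>C\<in>Q - {C0}. proj_measure Y C) = (\<Sum>C\<in>Q - {C0}. \<Sum>n | Some n \<in> C. P_op Y n)"
    using None by (intro sum.cong) (simp_all add: proj_measure_def)
  ultimately show ?thesis using C0(2) by (simp add: proj_measure_def)
qed

section \<open>Riemann sums over partitions that isolate finitely many points\<close>

lemma riemann_sum_shift:
  assumes "\<beta> \<in> tagged_partitions Nstar"
  shows "riemann_sum \<beta> f (proj_measure Y) =
    scale_bop a id_bop + (\<Sum>(C, x)\<in>\<beta>. scale_bop (f x - a) (proj_measure Y C))"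
proof -
  have \<beta>: "finite \<beta>" "inj_on fst \<beta>" "partition_on UNIV (fst ` \<beta>)" "fst ` \<beta> \<subseteq> clopens Nstar"
    using assms by (simp_all add: tagged_partitions_def topspace_Nstar)
  have id: "(\<Sum>p\<in>\<beta>. proj_measure Y (fst p)) = id_bop"
    using sum_proj_measure[OF _ \<beta>(3,4), of Y] \<beta>(1) by (simp add: sum.reindex[OF \<beta>(2)] o_def)
  \<comment> \<open>The cell measures add up to the identity, so a constant function has the same
    Riemann sum for every partition. Later \<open>a\<close> is the value of \<open>f\<close> at
    infinity, which leaves small coefficients outside a finite set.\<close>
  have "scale_bop a id_bop = (\<Sum>(C, x)\<in>\<beta>. scale_bop a (proj_measure Y C))"
    by (simp add: case_prod_unfold id flip: scale_bop_sum_right)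
  then show ?thesis
    by (simp add: riemann_sum_def case_prod_unfold sum.distrib[symmetric] scale_bop_add_left[symmetric])
qed

lemma isolating_partition_exists:
  obtains \<alpha> where "\<alpha> \<in> tagged_partitions Nstar"
    "fst ` \<alpha> = insert (- Some ` {..<N}) ((\<lambda>i. {Some i}) ` {..<N})"
proof (rule tagged_partition_exists)
  let ?Q = "insert (- Some ` {..<N}) ((\<lambda>i. {Some i}) ` {..<N})"
  show "finite ?Q" by simp
  show "partition_on (topspace Nstar) ?Q"
    by (rule partition_onI) (auto simp: topspace_Nstar disjnt_def)
  have "{n. Some n \<in> Some ` {..<N}} = {..<N}" by auto
  then show "?Q \<subseteq> clopens Nstar"
    by (auto simp: clopens_Nstar)
qed (use that in blast)

text \<open>A cell of the refinement that contains \<open>Some i\<close> with \<open>i < N\<close>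
  lies inside that singleton, hence equals it, and its tag is forced. Conversely, a tag lies in its
  own cell, so a tag \<open>Some i\<close> comes only from this cell.\<close>

lemma isolated_tags:
  assumes \<beta>: "\<beta> \<in> tagged_partitions Nstar"
    and ref: "refines UNIV (fst ` \<beta>) (insert (- Some ` {..<N}) ((\<lambda>i. {Some i}) ` {..<N}))"
  shows "{(C, x) \<in> \<beta>. x \<in> Some ` {..<N}} = (\<lambda>i. ({Some i}, Some i)) ` {..<N}"
proof -
  have single: "C = {Some i}" if C: "C \<in> fst ` \<beta>" "Some i \<in> C" "i < N" for C i
  proof -
    obtain D where "D \<in> insert (- Some ` {..<N}) ((\<lambda>i. {Some i}) ` {..<N})" "C \<subseteq> D"
      using ref C(1) unfolding refines_def by blast
    with C show ?thesis by auto
  qed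
  have tag: "x \<in> C" if "(C, x) \<in> \<beta>" for C x
    using \<beta> that by (auto simp: tagged_partitions_def)
  have "({Some i}, Some i) \<in> \<beta>" if "i < N" for i
  proof -
    have "\<Union> (fst ` \<beta>) = UNIV"
      using \<beta> by (simp add: tagged_partitions_def partition_on_def topspace_Nstar)
    then obtain p where p: "p \<in> \<beta>" "Some i \<in> fst p"
      using UNIV_I[of "Some i"] by (metis UN_E)
    obtain C x where Cx: "p = (C, x)" by (cases p)
    have "C = {Some i}"
      by (rule single[of C i]) (use p Cx that in \<open>auto intro: rev_image_eqI\<close>)
    then show ?thesis using tag[of C x] p(1) Cx by simp
  qed
  moreover have "C = {Some i}" if "(C, Some i) \<in> \<beta>" "i < N" for C i
    by (rule single[OF rev_image_eqI[OF that(1)] tag[OF that(1)] that(2)]) simp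
  ultimately show ?thesis by auto
qed

text \<open>The isolated cells reproduce the subtracted finite sum exactly. Every other term is a
  coefficient of norm at most \<open>B\<close> times a measure of norm at most 1.\<close>

lemma vnorm_riemann_sum_diff_le:
  fixes Y :: "nat \<Rightarrow> 'k::complete_valued_field c0"
  assumes "formally_real (residue_field :: 'k set ring)" "orthonormal_seq Y"
    and \<beta>: "\<beta> \<in> tagged_partitions Nstar"
    and ref: "refines UNIV (fst ` \<beta>) (insert (- Some ` {..<N}) ((\<lambda>i. {Some i}) ` {..<N}))"
    and B: "\<And>x. x \<notin> Some ` {..<N} \<Longrightarrow> vnorm (f x - a) \<le> B" "0 \<le> B"
  shows "vnorm (riemann_sum \<beta> f (proj_measure Y) -
    (scale_bop a id_bop + (\<Sum>i<N. scale_bop (f (Some i) - a) (P_op Y i)))) \<le> B"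
proof -
  let ?g = "\<lambda>(C, x). scale_bop (f x - a) (proj_measure Y C)"
  let ?J = "{(C, x) \<in> \<beta>. x \<in> Some ` {..<N}}"
  have "finite \<beta>" "?J \<subseteq> \<beta>" using \<beta> by (auto simp: tagged_partitions_def)
  then have "sum ?g \<beta> = sum ?g (\<beta> - ?J) + sum ?g ?J"
    by (rule sum.subset_diff[rotated])
  also have "sum ?g ?J = (\<Sum>i<N. scale_bop (f (Some i) - a) (P_op Y i))"
    unfolding isolated_tags[OF \<beta> ref]
    by (subst sum.reindex) (auto simp: inj_on_def proj_measure_def)
  finally have "riemann_sum \<beta> f (proj_measure Y) -
      (scale_bop a id_bop + (\<Sum>i<N. scale_bop (f (Some i) - a) (P_op Y i))) = sum ?g (\<beta> - ?J)"
    by (simp add: riemann_sum_shift[OF \<beta>, of f Y a])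
  also have "vnorm (sum ?g (\<beta> - ?J)) \<le> B"
  proof (rule vnorm_sum_le[OF _ B(2)])
    fix p assume "p \<in> \<beta> - ?J"
    then obtain C x where p: "p = (C, x)" "x \<notin> Some ` {..<N}" by (cases p) blast
    have "vnorm (?g p) \<le> vnorm (f x - a) * vnorm (proj_measure Y C)"
      by (simp add: p vnorm_scale_bop_le)
    also have "\<dots> \<le> B * 1"
      using B p by (intro mult_mono vnorm_proj_measure_le assms(1,2)) simp_all
    finally show "vnorm (?g p) \<le> B" by simp
  qed
  finally show ?thesis .
qed

section \<open>Continuity at infinity and convergence of the Riemann sums\<close>

lemma continuous_map_Nstar:
  fixes g :: "nat \<Rightarrow> 'a::topological_space"
  assumes "g \<longlonglongrightarrow> a"
  shows "continuous_map Nstar euclidean (case_option a g)"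
  unfolding continuous_map_def openin_Nstar topspace_Nstar
proof (intro conjI allI impI)
  fix U :: "'a set"
  assume "openin euclidean U" and "None \<in> {x \<in> UNIV. case_option a g x \<in> U}"
  then have "\<forall>\<^sub>F n in sequentially. g n \<in> U"
    using topological_tendstoD[OF assms, of U] by simp
  then show "finite {n. Some n \<notin> {x \<in> UNIV. case_option a g x \<in> U}}"
    \<comment> \<open>Neighbourhoods of infinity are cofinite, and on the natural numbers the
      cofinite filter is the one of sequential limits.\<close>
    by (simp flip: eventually_cofinite cofinite_eq_sequentially)
qed auto

theorem theorem2p10:
  fixes Y :: "nat \<Rightarrow> 'k::complete_valued_field c0" and H :: "'k bop"
  assumes "formally_real (residue_field :: 'k set ring)"
    and "orthonormal_seq Y"
    and "H \<in> S_alg Y"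
  shows "\<exists>f. continuous_map Nstar euclidean f \<and>
             has_measure_integral f (proj_measure Y) Nstar H"
proof -
  obtain a l where H: "H = scale_bop a id_bop + T_op Y l"
    using assms(3) by (auto simp: S_alg_def)
  define f where "f = case_option a (\<lambda>n. a + c0_nth l n)"
  define g where "g i = scale_bop (c0_nth l i) (P_op Y i)" for i
  have "(\<lambda>n. a + c0_nth l n) \<longlonglongrightarrow> a"
    using na_tendsto_add[OF tendsto_const c0_nth_tendsto, of a l] by simp
  then have cont: "continuous_map Nstar euclidean f"
    unfolding f_def by (rule continuous_map_Nstar)
  have g_le: "vnorm (g i) \<le> vnorm (c0_nth l i)" for i
    using vnorm_scale_bop_le[of "c0_nth l i" "P_op Y i"]
      mult_left_mono[OF vnorm_P_op_le[OF assms(1,2)] vnorm_nonneg, of "c0_nth l i" i]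
    by (simp add: g_def)
  have "(\<lambda>i. vnorm (g i)) \<longlonglongrightarrow> 0"
  proof (rule tendsto_sandwich[OF _ _ tendsto_const])
    show "(\<lambda>i. vnorm (c0_nth l i)) \<longlonglongrightarrow> 0"
      using na_tendsto_norm[OF c0_nth_tendsto] by simp
  qed (simp_all add: g_le)
  then have "g \<longlonglongrightarrow> 0" by (simp add: na_LIMSEQ_iff)
  \<comment> \<open>This gives \<open>T_op\<close> its content: \<open>suminf\<close> is tied to the
    partial sums only for a summable series.\<close>
  then have summable: "summable g" by (rule nonarch_summable)
  have "\<forall>\<^sub>F \<alpha> in refinement_filter Nstar. dist (riemann_sum \<alpha> f (proj_measure Y)) H < e"
    if "0 < e" for e
  proof -
    obtain N where N: "\<And>n. n \<ge> N \<Longrightarrow> vnorm (c0_nth l n) < e / 2"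
      using metric_LIMSEQ_D[OF c0_nth_tendsto, of "e / 2" l] \<open>0 < e\<close> unfolding vnorm_dist0 by auto
    \<comment> \<open>The truncation of \<open>H\<close> at \<open>N\<close> serves as the
      intermediate point between \<open>H\<close> and the Riemann sums.\<close>
    let ?h = "scale_bop a id_bop + sum g {..<N}"
    have tail: "vnorm (?h - H) \<le> e / 2"
    proof -
      have "vnorm (g n) \<le> e / 2" if "n \<ge> N" for n
        using g_le[of n] N[OF that] by linarith
      then have "vnorm (suminf g - sum g {..<N}) \<le> e / 2"
        using \<open>0 < e\<close> by (intro vnorm_suminf_tail summable) simp_all
      moreover have "H = scale_bop a id_bop + suminf g"
        unfolding H T_op_def g_def ..
      ultimately show ?thesis
        by (metis add_diff_cancel_left vnorm_diff_commute)
    qed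
    have f_le: "vnorm (f x - a) \<le> e / 2" if "x \<notin> Some ` {..<N}" for x
      \<comment> \<open>At \<open>None\<close> the difference is 0; at \<open>Some n\<close> with
        \<open>N \<le> n\<close> it is the coordinate \<open>c0_nth l n\<close>.\<close>
      using that N \<open>0 < e\<close> by (cases x) (auto simp: f_def image_iff not_less less_imp_le)
    obtain \<alpha> where \<alpha>: "\<alpha> \<in> tagged_partitions Nstar"
      "fst ` \<alpha> = insert (- Some ` {..<N}) ((\<lambda>i. {Some i}) ` {..<N})"
      by (rule isolating_partition_exists)
    have "dist (riemann_sum \<beta> f (proj_measure Y)) H < e"
      if "\<beta> \<in> tagged_partitions Nstar" "refines (topspace Nstar) (fst ` \<beta>) (fst ` \<alpha>)" for \<beta>
    proof -
      have "vnorm (riemann_sum \<beta> f (proj_measure Y) - ?h) \<le> e / 2"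
        using vnorm_riemann_sum_diff_le[OF assms(1,2) that(1), of N f a "e / 2"] that(2) f_le \<open>0 < e\<close>
        by (simp add: \<alpha>(2) topspace_Nstar f_def g_def)
      \<comment> \<open>The two bounds combine by maximum rather than by sum; halving
        \<open>e\<close> only secures strictness.\<close>
      then show ?thesis
        using tail vnorm_ultra[of "riemann_sum \<beta> f (proj_measure Y) - ?h" "?h - H"] \<open>0 < e\<close>
        by (simp add: dist_vnorm)
    qed
    then show ?thesis
      using \<alpha>(1) by (subst eventually_refinement_filter) (auto simp: topspace_Nstar)
  qed
  then have "has_measure_integral f (proj_measure Y) Nstar H"
    unfolding has_measure_integral_def by (rule tendstoI)
  with cont show ?thesis by blast
qed

end
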